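(* Let $\mathcal{X},\mathcal{Z}$ be Euclidean spaces (finite-dimensional real Hilbert spaces), and let $\phi,h,\mathfrak{S},g$ satisfy: (i) $\phi:\mathcal{X}\to\mathbb{R}\cup\{+\infty\}$ is proper, lower semicontinuous, convex (and prox-friendly); (ii) $h:\mathcal{X}\to\mathbb{R}$ is differentiable and $\nabla h:\mathcal{X}\to\mathcal{X}$ is Lipschitz continuous over $\mathrm{dom}(\phi)=\{\bm{x}\in\mathcal{X}\mid\phi(\bm{x})<+\infty\}$; (iii) $\mathfrak{S}:\mathcal{X}\to\mathcal{Z}$ is a continuously differentiable mapping; (iv) $g:\mathcal{Z}\to\mathbb{R}$ is Lipschitz continuous and $\eta$-weakly convex with $\eta>0$, i.e., $g+\frac{\eta}{2}\|\cdot\|^2$ is convex (and $g$ is prox-friendly); (v) with $f:=h+g\circ\mathfrak{S}$, $\inf\{(f+\phi)(\bm{x})\mid\bm{x}\in\mathrm{dom}(\phi)\}>-\infty$. Let $\bar{\bm{x}}\in\mathcal{X}$ and $(\bm{x}_n)_{n=1}^\infty\subset\mathcal{X}$ be arbitrary with $\lim_{n\to\infty}\bm{x}_n=\bar{\bm{x}}$. Then, with the stationarity measure $\mathcal{M}_\gamma^{f,\phi}$ defined in the context, the following hold. (a) For every $\gamma>0$, $$\liminf_{n\to\infty}\mathcal{M}_\gamma^{f,\phi}(\bm{x}_n):=\sup_{n\in\mathbb{N}}\inf_{k\ge n}\mathcal{M}_\gamma^{f,\phi}(\bm{x}_k)\ \ge\ \mathcal{M}_\gamma^{f,\phi}(\bar{\bm{x}}).$$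 (b) Let $(\mu_n)_{n=1}^\infty\subset(0,\eta^{-1})$ satisfy $\mu_n\searrow0$ as $n\to\infty$, and let $f_n:=h+{}^{\mu_n}g\circ\mathfrak{S}$, where ${}^{\mu_n}g$ is the Moreau envelope of $g$ of index $\mu_n$. Then, for every $\gamma>0$, $$\liminf_{n\to\infty}\mathcal{M}_\gamma^{f_n,\phi}(\bm{x}_n)\ \ge\ \mathcal{M}_\gamma^{f,\phi}(\bar{\bm{x}}).$$ Moreover, if $\liminf_{n\to\infty}\mathcal{M}_\gamma^{f_n,\phi}(\bm{x}_n)=0$ for some $\gamma>0$, then $\bar{\bm{x}}$ is a stationary point of $f+\phi$.
   Context: Prox-friendly: the proximity operator has a closed-form expression (an informal computability requirement). Subdifferentials. For $J:\mathcal{X}\to\mathbb{R}\cup\{+\infty\}$ and $\bar{\bm{x}}\in\mathrm{dom}(J)$, the regular subdifferential is $$\widehat\partial J(\bar{\bm{x}}):=\Big\{\bm{v}\in\mathcal{X}\ \Big|\ \liminf_{\bm{x}\to\bar{\bm{x}},\,\bm{x}\ne\bar{\bm{x}}}\frac{J(\bm{x})-J(\bar{\bm{x}})-\langle\bm{v},\bm{x}-\bar{\bm{x}}\rangle}{\|\bm{x}-\bar{\bm{x}}\|}\ge0\Big\},$$ and the general subdifferential $\partial J(\bar{\bm{x}})$ is the set of all $\bm{v}\in\mathcal{X}$ for which there exist $\bm{x}_n\to\bar{\bm{x}}$ with $J(\bm{x}_n)\to J(\bar{\bm{x}})$ and $\bm{v}_n\in\widehat\partial J(\bm{x}_n)$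 with $\bm{v}_n\to\bm{v}$. Both are $\emptyset$ if $\bar{\bm{x}}\notin\mathrm{dom}(J)$. For convex $J$ both coincide with the convex subdifferential. Stationary point: $\bm{x}^\star\in\mathcal{X}$ is a stationary point of $f+\phi$ if $\bm{0}\in\partial(f+\phi)(\bm{x}^\star)\ (=\partial f(\bm{x}^\star)+\partial\phi(\bm{x}^\star))$. Proximity operators and Moreau envelope. For $\gamma>0$, $\mathrm{prox}_{\gamma\phi}(\bar{\bm{x}}):=\operatorname{argmin}_{\bm{x}\in\mathcal{X}}\big(\phi(\bm{x})+\frac1{2\gamma}\|\bm{x}-\bar{\bm{x}}\|^2\big)$, which is single-valued. For $\mu\in(0,\eta^{-1})$, the Moreau envelope of $g$ of index $\mu$ is ${}^{\mu}g(\bar{\bm{z}}):=\min_{\bm{z}\in\mathcal{Z}}\big(g(\bm{z})+\frac1{2\mu}\|\bm{z}-\bar{\bm{z}}\|^2\big)$, which is continuously differentiable. The notation ${}^{\mu}g\circ\mathfrak{S}$ means $({}^{\mu}g)\circ\mathfrak{S}$. Stationarity measure. For $F:\mathcal{X}\to\mathbb{R}$ (used with $F=f$ and $F=f_n$), $\gamma>0$ and $\bar{\bm{x}}\in\mathcal{X}$, $$\mathcal{M}_\gamma^{F,\phi}(\bar{\bm{x}}):=\inf\big\{\gamma^{-1}\|\bar{\bm{x}}-\mathrm{prox}_{\gamma\phi}(\bar{\bm{x}}-\gamma\bm{v})\|\ \big|\ \bm{v}\in\partial F(\bar{\bm{x}})\big\}.$$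
   Formalization: The formal theorem additionally assumes that ∇h is continuous at the limit point x̄; with h merely differentiable and ∇h Lipschitz only over dom(φ), both (a) and (b) can fail when x̄ is not interior to dom(φ). *)

theory Defs
  imports "HOL-Analysis.Analysis"
begin

text \<open>Functions into \<open>\<real> \<union> {+\<infinity>}\<close> are modelled as \<^typ>\<open>'a \<Rightarrow> ereal\<close>; the value \<open>-\<infinity>\<close> is
  excluded by \<open>proper\<close> below.\<close>

definition edom :: "('a \<Rightarrow> ereal) \<Rightarrow> 'a set" where
  "edom J = {x. J x < \<infinity>}"

definition proper :: "('a \<Rightarrow> ereal) \<Rightarrow> bool" where
  "proper J \<longleftrightarrow> (\<forall>x. J x \<noteq> -\<infinity>) \<and> edom J \<noteq> {}"

definition lsc :: "('a::topological_space \<Rightarrow> ereal) \<Rightarrow> bool" where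
  "lsc J \<longleftrightarrow> (\<forall>x. J x \<le> Liminf (at x) J)"

definition econvex :: "('a::real_vector \<Rightarrow> ereal) \<Rightarrow> bool" where
  "econvex J \<longleftrightarrow> (\<forall>x y t. 0 < t \<and> t < 1 \<longrightarrow>
     J ((1 - t) *\<^sub>R x + t *\<^sub>R y) \<le> ereal (1 - t) * J x + ereal t * J y)"

definition weakly_convex :: "real \<Rightarrow> ('b::real_normed_vector \<Rightarrow> real) \<Rightarrow> bool" where
  "weakly_convex \<eta> g \<longleftrightarrow> convex_on UNIV (\<lambda>z. g z + \<eta> / 2 * (norm z)\<^sup>2)"

definition C1_map :: "('a::real_normed_vector \<Rightarrow> 'b::real_normed_vector) \<Rightarrow> bool" where
  "C1_map S \<longleftrightarrow> (\<exists>S' :: 'a \<Rightarrow> 'a \<Rightarrow>\<^sub>L 'b.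
     (\<forall>x. (S has_derivative blinfun_apply (S' x)) (at x)) \<and> continuous_on UNIV S')"

definition regular_subdiff :: "('a::real_inner \<Rightarrow> ereal) \<Rightarrow> 'a \<Rightarrow> 'a set" where
  "regular_subdiff J xb = {v. xb \<in> edom J \<and>
     Liminf (at xb) (\<lambda>x. (J x - J xb - ereal (v \<bullet> (x - xb))) / ereal (norm (x - xb))) \<ge> 0}"

definition subdiff :: "('a::real_inner \<Rightarrow> ereal) \<Rightarrow> 'a \<Rightarrow> 'a set" where
  "subdiff J xb = {v. xb \<in> edom J \<and>
     (\<exists>x w. x \<longlonglongrightarrow> xb \<and> (\<lambda>n. J (x n)) \<longlonglongrightarrow> J xb \<and>
            (\<forall>n. w n \<in> regular_subdiff J (x n)) \<and> w \<longlonglongrightarrow> v)}"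

definition stationary_point :: "('a::real_inner \<Rightarrow> ereal) \<Rightarrow> 'a \<Rightarrow> bool" where
  "stationary_point J x \<longleftrightarrow> 0 \<in> subdiff J x"

text \<open>\<open>prox \<gamma> \<phi>\<close> is the operator \<open>prox\<^bsub>\<gamma>\<phi>\<^esub>\<close>; the minimiser is unique for \<open>\<gamma> > 0\<close> and \<open>\<phi>\<close>
  proper, lower semicontinuous and convex.\<close>

definition prox :: "real \<Rightarrow> ('a::real_normed_vector \<Rightarrow> ereal) \<Rightarrow> 'a \<Rightarrow> 'a" where
  "prox \<gamma> \<phi> xb = arg_min (\<lambda>x. \<phi> x + ereal (1 / (2 * \<gamma>) * (norm (x - xb))\<^sup>2)) (\<lambda>_. True)"

text \<open>The infimum is attained (it is a minimum) for \<open>g\<close> Lipschitz and \<open>\<eta>\<close>-weakly convex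
  and \<open>0 < \<mu> < 1 / \<eta>\<close>.\<close>

definition moreau_envelope :: "real \<Rightarrow> ('b::real_normed_vector \<Rightarrow> real) \<Rightarrow> 'b \<Rightarrow> real" where
  "moreau_envelope \<mu> g zb = (INF z. g z + 1 / (2 * \<mu>) * (norm (z - zb))\<^sup>2)"

text \<open>Extended-real valued, so that the infimum over an empty subdifferential is \<open>+\<infinity>\<close>.\<close>

definition stat_measure ::
  "real \<Rightarrow> ('a::real_inner \<Rightarrow> real) \<Rightarrow> ('a \<Rightarrow> ereal) \<Rightarrow> 'a \<Rightarrow> ereal" where
  "stat_measure \<gamma> F \<phi> xb =
     (INF v \<in> subdiff (\<lambda>x. ereal (F x)) xb.
        ereal (inverse \<gamma> * norm (xb - prox \<gamma> \<phi> (xb - \<gamma> *\<^sub>R v))))"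

end

theory Submission
  imports Defs
begin

text \<open>Near \<open>xbar\<close> the functions \<open>f\<close> and \<open>f\<^sub>n\<close> satisfy the convexity inequality up to an error
  \<open>\<epsilon> t (1 - t) \<parallel>u - y\<parallel>\<close>, on a ball that depends on \<open>\<epsilon>\<close> but not on \<open>n\<close>: \<open>h\<close> and \<open>S\<close> are strictly
  differentiable at \<open>xbar\<close>, while \<open>g\<close> and its Moreau envelopes share a Lipschitz constant and, once
  \<open>\<mu> \<le> 1 / (2 \<eta>)\<close>, a weak convexity constant. Limiting subgradients of such functions satisfy the
  subgradient inequality on that ball up to \<open>\<epsilon> \<parallel>u - y\<parallel>\<close>. Since \<open>f\<^sub>n \<rightarrow> f\<close> uniformly, subgradients at
  \<open>x\<^sub>n\<close> are bounded, and their cluster points are regular subgradients of \<open>f\<close> at \<open>xbar\<close>. With the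
  continuity of the proximity operator, every finite lower limit of the stationarity measures
  bounds the residual of some regular subgradient at \<open>xbar\<close>. If that residual is zero, the prox
  inequality makes \<open>0\<close> a regular subgradient of \<open>f + \<phi>\<close>.\<close>

lemma norm_sq_convex_combination:
  fixes a b :: "'a::real_inner"
  shows "(norm ((1 - t) *\<^sub>R a + t *\<^sub>R b))\<^sup>2 =
    (1 - t) * (norm a)\<^sup>2 + t * (norm b)\<^sup>2 - t * (1 - t) * (norm (a - b))\<^sup>2"
  by (simp add: power2_norm_eq_inner inner_add_left inner_add_right inner_diff_left
      inner_diff_right inner_commute algebra_simps)

lemma weakly_convexD:
  fixes g :: "'a::real_inner \<Rightarrow> real"
  assumes "weakly_convex \<eta> g" "0 < t" "t < 1"
  shows "g ((1 - t) *\<^sub>R a + t *\<^sub>R b) \<le>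
    (1 - t) * g a + t * g b + \<eta> / 2 * (t * (1 - t)) * (norm (a - b))\<^sup>2"
proof -
  have "g ((1 - t) *\<^sub>R a + t *\<^sub>R b) + \<eta> / 2 * (norm ((1 - t) *\<^sub>R a + t *\<^sub>R b))\<^sup>2 \<le>
    (1 - t) * (g a + \<eta> / 2 * (norm a)\<^sup>2) + t * (g b + \<eta> / 2 * (norm b)\<^sup>2)"
    using convex_onD[of UNIV "\<lambda>z. g z + \<eta> / 2 * (norm z)\<^sup>2" t a b] assms
    unfolding weakly_convex_def by auto
  then show ?thesis
    unfolding norm_sq_convex_combination
    by (simp add: algebra_simps add_divide_distrib diff_divide_distrib)
qed

subsection \<open>Nearly convex functions\<close>

definition nearly_convex_on :: "'a::real_normed_vector set \<Rightarrow> real \<Rightarrow> ('a \<Rightarrow> real) \<Rightarrow> bool" where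
  "nearly_convex_on U e F \<longleftrightarrow> (\<forall>u\<in>U. \<forall>y\<in>U. \<forall>t. 0 < t \<and> t < 1 \<longrightarrow>
     F ((1 - t) *\<^sub>R y + t *\<^sub>R u) \<le> (1 - t) * F y + t * F u + e * (t * (1 - t)) * norm (u - y))"

lemma strictly_differentiable:
  fixes f :: "'a::real_normed_vector \<Rightarrow> 'b::real_normed_vector"
  assumes der: "\<And>x. (f has_derivative blinfun_apply (f' x)) (at x)"
    and cont: "isCont f' x0" and "e > 0"
  obtains d where "d > 0"
    "\<And>a b. a \<in> ball x0 d \<Longrightarrow> b \<in> ball x0 d \<Longrightarrow>
      norm (f b - f a - blinfun_apply (f' x0) (b - a)) \<le> e * norm (b - a)"
proof -
  obtain d where d: "d > 0" "\<And>y. dist y x0 < d \<Longrightarrow> dist (f' y) (f' x0) < e"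
    using cont \<open>e > 0\<close> by (metis continuous_at_eps_delta)
  have "norm (f b - f a - blinfun_apply (f' x0) (b - a)) \<le> e * norm (b - a)"
    if "a \<in> ball x0 d" "b \<in> ball x0 d" for a b
  proof -
    have "norm (f b - f a - blinfun_apply (f' x0) (b - a)) \<le> norm (b - a) * e"
    proof (rule differentiable_bound_linearization[where S = "ball x0 d" and f' = "\<lambda>x. blinfun_apply (f' x)"])
      show "a + t *\<^sub>R (b - a) \<in> ball x0 d" if "t \<in> {0..1}" for t
      proof -
        have "(1 - t) *\<^sub>R a + t *\<^sub>R b \<in> ball x0 d"
          using \<open>a \<in> ball x0 d\<close> \<open>b \<in> ball x0 d\<close> that by (intro convexD[OF convex_ball]) auto
        then show ?thesis by (simp add: algebra_simps)
      qed
      show "(f has_derivative blinfun_apply (f' x)) (at x within ball x0 d)" for x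
        using der has_derivative_at_withinI by blast
      show "onorm (blinfun_apply (f' x) - blinfun_apply (f' x0)) \<le> e" if "x \<in> ball x0 d" for x
      proof -
        have "norm (f' x - f' x0) < e"
          using d(2)[of x] that by (simp add: dist_commute dist_norm norm_minus_commute)
        moreover have "blinfun_apply (f' x) - blinfun_apply (f' x0) = blinfun_apply (f' x - f' x0)"
          by (auto simp: blinfun.diff_left)
        ultimately show ?thesis by (simp add: norm_blinfun.rep_eq)
      qed
      show "x0 \<in> ball x0 d" using d by simp
    qed
    then show ?thesis by (simp add: mult.commute)
  qed
  with d(1) show ?thesis using that by blast
qed

lemma linear_approx_convex_combination:
  fixes f :: "'a::real_normed_vector \<Rightarrow> 'b::real_normed_vector"
  assumes approx: "\<And>a b. a \<in> U \<Longrightarrow> b \<in> U \<Longrightarrow> norm (f b - f a - A (b - a)) \<le> e * norm (b - a)"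
    and "linear A" "convex U" "u \<in> U" "y \<in> U" "0 < t" "t < 1"
  shows "norm (f ((1 - t) *\<^sub>R y + t *\<^sub>R u) - ((1 - t) *\<^sub>R f y + t *\<^sub>R f u))
    \<le> 2 * e * (t * (1 - t)) * norm (u - y)"
proof -
  let ?p = "(1 - t) *\<^sub>R y + t *\<^sub>R u"
  have p: "?p \<in> U" using assms by (intro convexD) auto
  have 1: "?p - y = t *\<^sub>R (u - y)" "?p - u = (t - 1) *\<^sub>R (u - y)"
    by (simp_all add: algebra_simps)
  have y: "norm (f ?p - f y - t *\<^sub>R A (u - y)) \<le> e * (t * norm (u - y))"
    using approx[OF \<open>y \<in> U\<close> p] assms by (simp add: 1 linear_cmul)
  have u: "norm (f ?p - f u - (t - 1) *\<^sub>R A (u - y)) \<le> e * ((1 - t) * norm (u - y))"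
    using approx[OF \<open>u \<in> U\<close> p] assms by (simp add: 1 linear_cmul)
  have "f ?p - ((1 - t) *\<^sub>R f y + t *\<^sub>R f u) =
      (1 - t) *\<^sub>R (f ?p - f y - t *\<^sub>R A (u - y)) + t *\<^sub>R (f ?p - f u - (t - 1) *\<^sub>R A (u - y))"
    by (simp add: algebra_simps)
  also have "norm \<dots> \<le> (1 - t) * (e * (t * norm (u - y))) + t * (e * ((1 - t) * norm (u - y)))"
    using y u assms by (intro norm_triangle_mono) (auto intro!: mult_left_mono)
  finally show ?thesis by (simp add: algebra_simps)
qed

lemma nearly_convex_composite:
  fixes h :: "'a::real_inner \<Rightarrow> real" and S :: "'a \<Rightarrow> 'b::real_normed_vector"
  assumes h: "\<And>u. GDERIV h u :> gradh u" "isCont gradh x0"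
    and S: "C1_map S" and "K \<ge> 0" "C \<ge> 0" "e > 0"
  shows "\<exists>d>0. \<forall>G. (K-lipschitz_on UNIV G \<and>
     (\<forall>a b t. 0 < t \<and> t < 1 \<longrightarrow> G ((1 - t) *\<^sub>R a + t *\<^sub>R b) \<le>
        (1 - t) * G a + t * G b + C * (t * (1 - t)) * (norm (a - b))\<^sup>2)) \<longrightarrow>
     nearly_convex_on (ball x0 d) e (\<lambda>u. h u + G (S u))"
proof -
  obtain S' where S': "\<And>x. (S has_derivative blinfun_apply (S' x)) (at x)" "isCont S' x0"
    using S unfolding C1_map_def by (auto simp: continuous_on_eq_continuous_at)
  define h' where "h' u = blinfun_inner_left (gradh u)" for u
  have h': "(h has_derivative blinfun_apply (h' u)) (at u)" for u
    using h(1)[of u] unfolding gderiv_def h'_def by (simp add: inner_commute)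
  have h'c: "isCont h' x0"
    unfolding h'_def using bounded_linear.isCont[OF bounded_linear_blinfun_inner_left h(2)] .
  define e1 where "e1 = min 1 (e / (4 * (1 + K)))"
  have "e1 \<le> e / (4 * (1 + K))" unfolding e1_def by simp
  then have "4 * e1 * (1 + K) \<le> e" using \<open>K \<ge> 0\<close> by (simp add: pos_le_divide_eq mult_ac)
  moreover have "e1 > 0" "e1 \<le> 1" using \<open>e > 0\<close> \<open>K \<ge> 0\<close> unfolding e1_def by auto
  ultimately have e1: "e1 > 0" "e1 \<le> 1" "4 * e1 * (1 + K) \<le> e" by auto
  define M where "M = norm (S' x0) + 1"
  have M: "M > 0" unfolding M_def by (simp add: add_nonneg_pos)
  obtain d1 where d1: "d1 > 0" "\<And>a b. a \<in> ball x0 d1 \<Longrightarrow> b \<in> ball x0 d1 \<Longrightarrow>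
      norm (h b - h a - blinfun_apply (h' x0) (b - a)) \<le> e1 * norm (b - a)"
    using strictly_differentiable[OF h' h'c e1(1)] by blast
  obtain d2 where d2: "d2 > 0" "\<And>a b. a \<in> ball x0 d2 \<Longrightarrow> b \<in> ball x0 d2 \<Longrightarrow>
      norm (S b - S a - blinfun_apply (S' x0) (b - a)) \<le> e1 * norm (b - a)"
    using strictly_differentiable[OF S' e1(1)] by blast
  define d where "d = min (min d1 d2) (e / (4 * (C * M\<^sup>2 + 1)))"
  have CM: "C * M\<^sup>2 + 1 > 0" using \<open>C \<ge> 0\<close> by (simp add: add_nonneg_pos)
  have d: "d > 0" "d \<le> d1" "d \<le> d2"
    using d1(1) d2(1) \<open>e > 0\<close> CM unfolding d_def by auto
  have "d \<le> e / (4 * (C * M\<^sup>2 + 1))" unfolding d_def by simp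
  then have "(C * M\<^sup>2 + 1) * (2 * d) \<le> e / 2" using CM by (simp add: field_simps)
  then have d3: "C * M\<^sup>2 * (2 * d) \<le> e / 2" using d(1) by (simp add: algebra_simps)
  have "nearly_convex_on (ball x0 d) e (\<lambda>u. h u + G (S u))"
    if lip: "K-lipschitz_on UNIV G" and wc: "\<And>a b t. 0 < t \<Longrightarrow> t < 1 \<Longrightarrow>
        G ((1 - t) *\<^sub>R a + t *\<^sub>R b) \<le>
        (1 - t) * G a + t * G b + C * (t * (1 - t)) * (norm (a - b))\<^sup>2" for G
    unfolding nearly_convex_on_def
  proof (intro ballI allI impI)
    fix u y and t :: real assume uy: "u \<in> ball x0 d" "y \<in> ball x0 d" and "0 < t \<and> t < 1"
    then have t: "0 < t" "t < 1" by auto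
    let ?p = "(1 - t) *\<^sub>R y + t *\<^sub>R u" and ?s = "t * (1 - t)" and ?q = "(1 - t) *\<^sub>R S y + t *\<^sub>R S u"
    have s: "?s > 0" using t by simp
    have "norm (h ?p - ((1 - t) *\<^sub>R h y + t *\<^sub>R h u)) \<le> 2 * e1 * ?s * norm (u - y)"
      using uy d t d1(2) by (intro linear_approx_convex_combination[where U = "ball x0 d"
            and A = "blinfun_apply (h' x0)"]) (auto simp: bounded_linear.linear blinfun.bounded_linear_right)
    then have H: "h ?p \<le> (1 - t) * h y + t * h u + 2 * e1 * ?s * norm (u - y)"
      by (simp add: abs_le_iff)
    have Sp: "norm (S ?p - ?q) \<le> 2 * e1 * ?s * norm (u - y)"
      using uy d t d2(2) by (intro linear_approx_convex_combination[where U = "ball x0 d"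
            and A = "blinfun_apply (S' x0)"]) (auto simp: bounded_linear.linear blinfun.bounded_linear_right)
    have "norm (G (S ?p) - G ?q) \<le> K * norm (S ?p - ?q)"
      using lipschitz_onD[OF lip, of "S ?p" ?q] by (simp add: dist_norm)
    also have "\<dots> \<le> K * (2 * e1 * ?s * norm (u - y))"
      using Sp \<open>K \<ge> 0\<close> by (rule mult_left_mono)
    finally have G1: "G (S ?p) \<le> G ?q + K * (2 * e1 * ?s * norm (u - y))"
      by (simp add: abs_le_iff)
    have "norm (S u - S y) \<le> norm (S u - S y - blinfun_apply (S' x0) (u - y)) + norm (blinfun_apply (S' x0) (u - y))"
      by (metis norm_triangle_sub add.commute)
    also have "\<dots> \<le> e1 * norm (u - y) + norm (S' x0) * norm (u - y)"
      using d2(2)[of y u] uy d by (intro add_mono norm_blinfun) auto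
    also have "\<dots> \<le> M * norm (u - y)"
      using mult_right_mono[OF e1(2), of "norm (u - y)"] unfolding M_def by (simp add: algebra_simps)
    finally have SM: "norm (S u - S y) \<le> M * norm (u - y)" .
    have uyd: "norm (u - y) \<le> 2 * d"
      using uy dist_triangle[of u y x0] by (simp add: dist_norm dist_commute norm_minus_commute)
    have "C * (norm (S y - S u))\<^sup>2 \<le> C * (M * norm (u - y))\<^sup>2"
      using SM \<open>C \<ge> 0\<close> by (intro mult_left_mono power_mono) (auto simp: norm_minus_commute)
    also have "\<dots> = C * M\<^sup>2 * norm (u - y) * norm (u - y)"
      by (simp add: power2_eq_square)
    also have "\<dots> \<le> C * M\<^sup>2 * (2 * d) * norm (u - y)"
      using uyd \<open>C \<ge> 0\<close> by (intro mult_right_mono mult_left_mono) auto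
    also have "\<dots> \<le> e / 2 * norm (u - y)"
      using d3 by (rule mult_right_mono) auto
    finally have G2: "C * (norm (S y - S u))\<^sup>2 \<le> e / 2 * norm (u - y)" .
    have "G ?q \<le> (1 - t) * G (S y) + t * G (S u) + ?s * (C * (norm (S y - S u))\<^sup>2)"
      using wc[OF t, of "S y" "S u"] by (simp add: mult_ac)
    also have "\<dots> \<le> (1 - t) * G (S y) + t * G (S u) + ?s * (e / 2 * norm (u - y))"
      using mult_left_mono[OF G2, of ?s] s by simp
    finally have "h ?p + G (S ?p) \<le> (1 - t) * (h y + G (S y)) + t * (h u + G (S u))
        + (2 * e1 * (1 + K) + e / 2) * (?s * norm (u - y))"
      using H G1 by (simp add: algebra_simps add_divide_distrib diff_divide_distrib)
    also have "\<dots> \<le> (1 - t) * (h y + G (S y)) + t * (h u + G (S u)) + e * (?s * norm (u - y))"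
    proof -
      have "(2 * e1 * (1 + K) + e / 2) \<le> e" using e1(3) by simp
      then show ?thesis using s by (intro add_left_mono mult_right_mono) auto
    qed
    finally show "h ?p + G (S ?p) \<le> (1 - t) * (h y + G (S y)) + t * (h u + G (S u)) + e * ?s * norm (u - y)"
      by (simp add: mult.assoc)
  qed
  with d(1) show ?thesis by blast
qed

subsection \<open>The Moreau envelope of a Lipschitz function\<close>

lemma moreau_integrand_lower:
  fixes g :: "'b::real_inner \<Rightarrow> real"
  assumes "K-lipschitz_on UNIV g" "\<mu> > 0"
  shows "g zb - K\<^sup>2 * \<mu> / 2 \<le> g z + 1 / (2 * \<mu>) * (norm (z - zb))\<^sup>2"
proof -
  have "g zb - g z \<le> K * norm (z - zb)"
    using lipschitz_onD[OF assms(1), of zb z] by (simp add: dist_norm norm_minus_commute abs_le_iff)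
  moreover have "0 \<le> (norm (z - zb) - K * \<mu>)\<^sup>2 / (2 * \<mu>)" using assms by simp
  then have "K * norm (z - zb) \<le> K\<^sup>2 * \<mu> / 2 + 1 / (2 * \<mu>) * (norm (z - zb))\<^sup>2"
    using assms(2) by (simp add: power2_eq_square field_simps)
  ultimately show ?thesis by simp
qed

lemma moreau_envelope_le:
  fixes g :: "'b::real_inner \<Rightarrow> real"
  assumes "K-lipschitz_on UNIV g" "\<mu> > 0"
  shows "moreau_envelope \<mu> g zb \<le> g z + 1 / (2 * \<mu>) * (norm (z - zb))\<^sup>2"
  unfolding moreau_envelope_def
  by (intro cINF_lower bdd_belowI2[where m = "g zb - K\<^sup>2 * \<mu> / 2"] moreau_integrand_lower[OF assms]) auto

lemma moreau_envelope_approx: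
  fixes g :: "'b::real_inner \<Rightarrow> real"
  assumes "K-lipschitz_on UNIV g" "\<mu> > 0"
  shows "\<bar>moreau_envelope \<mu> g z - g z\<bar> \<le> K\<^sup>2 * \<mu> / 2"
proof -
  have "moreau_envelope \<mu> g z \<le> g z" using moreau_envelope_le[OF assms, of z z] by simp
  moreover have "g z - K\<^sup>2 * \<mu> / 2 \<le> moreau_envelope \<mu> g z"
    unfolding moreau_envelope_def by (intro cINF_greatest moreau_integrand_lower[OF assms]) auto
  ultimately show ?thesis by simp
qed

lemma moreau_envelope_near_minimizer:
  fixes g :: "'b::real_inner \<Rightarrow> real"
  assumes "e > 0"
  obtains z where "g z + 1 / (2 * \<mu>) * (norm (z - zb))\<^sup>2 < moreau_envelope \<mu> g zb + e"
proof -
  have "\<exists>z. g z + 1 / (2 * \<mu>) * (norm (z - zb))\<^sup>2 < moreau_envelope \<mu> g zb + e"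
  proof (rule ccontr)
    assume "\<not> ?thesis"
    then have "moreau_envelope \<mu> g zb + e \<le> moreau_envelope \<mu> g zb"
      unfolding moreau_envelope_def[of \<mu> g zb]
      by (intro cINF_greatest) (auto simp: not_less moreau_envelope_def)
    with \<open>e > 0\<close> show False by simp
  qed
  then show ?thesis using that by blast
qed

lemma moreau_envelope_lipschitz:
  fixes g :: "'b::real_inner \<Rightarrow> real"
  assumes "K-lipschitz_on UNIV g" "\<mu> > 0"
  shows "K-lipschitz_on UNIV (moreau_envelope \<mu> g)"
proof -
  have *: "moreau_envelope \<mu> g a - moreau_envelope \<mu> g b \<le> K * norm (a - b)" for a b
  proof (rule field_le_epsilon)
    fix e :: real assume "e > 0"
    then obtain z where z: "g z + 1 / (2 * \<mu>) * (norm (z - b))\<^sup>2 < moreau_envelope \<mu> g b + e"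
      using moreau_envelope_near_minimizer by blast
    have "moreau_envelope \<mu> g a \<le> g (z + (a - b)) + 1 / (2 * \<mu>) * (norm (z + (a - b) - a))\<^sup>2"
      by (rule moreau_envelope_le[OF assms])
    moreover have "g (z + (a - b)) - g z \<le> K * norm (a - b)"
      using lipschitz_onD[OF assms(1), of "z + (a - b)" z] by (simp add: dist_norm abs_le_iff)
    ultimately show "moreau_envelope \<mu> g a - moreau_envelope \<mu> g b \<le> K * norm (a - b) + e"
      using z by simp
  qed
  show ?thesis
  proof (rule lipschitz_onI)
    show "dist (moreau_envelope \<mu> g a) (moreau_envelope \<mu> g b) \<le> K * dist a b" for a b
      using *[of a b] *[of b a] by (simp add: dist_norm norm_minus_commute abs_le_iff)
    show "0 \<le> K" using assms(1) by (rule lipschitz_on_nonneg)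
  qed
qed

lemma moreau_envelope_weakly_convex:
  fixes g :: "'b::real_inner \<Rightarrow> real"
  assumes lip: "K-lipschitz_on UNIV g" and \<mu>: "\<mu> > 0" "2 * \<mu> * \<eta> \<le> 1"
    and "\<eta> > 0" "weakly_convex \<eta> g" "0 < t" "t < 1"
  shows "moreau_envelope \<mu> g ((1 - t) *\<^sub>R a + t *\<^sub>R b) \<le>
    (1 - t) * moreau_envelope \<mu> g a + t * moreau_envelope \<mu> g b + \<eta> * (t * (1 - t)) * (norm (a - b))\<^sup>2"
proof (rule field_le_epsilon)
  fix e :: real assume "e > 0"
  let ?c = "1 / (2 * \<mu>)"
  obtain za where za: "g za + ?c * (norm (za - a))\<^sup>2 < moreau_envelope \<mu> g a + e"
    using moreau_envelope_near_minimizer[OF \<open>e > 0\<close>] by blast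
  obtain zb where zb: "g zb + ?c * (norm (zb - b))\<^sup>2 < moreau_envelope \<mu> g b + e"
    using moreau_envelope_near_minimizer[OF \<open>e > 0\<close>] by blast
  let ?z = "(1 - t) *\<^sub>R za + t *\<^sub>R zb" and ?p = "(1 - t) *\<^sub>R a + t *\<^sub>R b"
  let ?D = "za - zb" and ?d = "a - b"
  have "?z - ?p = (1 - t) *\<^sub>R (za - a) + t *\<^sub>R (zb - b)" by (simp add: algebra_simps)
  then have "(norm (?z - ?p))\<^sup>2 = (1 - t) * (norm (za - a))\<^sup>2 + t * (norm (zb - b))\<^sup>2
      - t * (1 - t) * (norm (?D - ?d))\<^sup>2"
    using norm_sq_convex_combination[of t "za - a" "zb - b"] by (simp add: algebra_simps)
  then have q: "?c * (norm (?z - ?p))\<^sup>2 = (1 - t) * (?c * (norm (za - a))\<^sup>2) + t * (?c * (norm (zb - b))\<^sup>2)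
      - t * (1 - t) * (?c * (norm (?D - ?d))\<^sup>2)"
    by (simp only: right_diff_distrib distrib_left mult.left_commute)
  have "(norm ?D)\<^sup>2 \<le> 2 * (norm (?D - ?d))\<^sup>2 + 2 * (norm ?d)\<^sup>2"
  proof -
    have "0 \<le> (norm (?D - 2 *\<^sub>R ?d))\<^sup>2" by simp
    then show ?thesis
      unfolding power2_norm_eq_inner
      by (simp add: inner_diff_left inner_diff_right inner_commute algebra_simps)
  qed
  then have "\<eta> / 2 * (norm ?D)\<^sup>2 \<le> \<eta> / 2 * (2 * (norm (?D - ?d))\<^sup>2 + 2 * (norm ?d)\<^sup>2)"
    using \<open>\<eta> > 0\<close> by (intro mult_left_mono) auto
  also have "\<dots> = \<eta> * (norm (?D - ?d))\<^sup>2 + \<eta> * (norm ?d)\<^sup>2" by (simp add: algebra_simps)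
  also have "\<eta> * (norm (?D - ?d))\<^sup>2 \<le> ?c * (norm (?D - ?d))\<^sup>2"
    using \<mu> by (intro mult_right_mono) (auto simp: field_simps)
  finally have "\<eta> / 2 * (norm ?D)\<^sup>2 - ?c * (norm (?D - ?d))\<^sup>2 \<le> \<eta> * (norm ?d)\<^sup>2" by simp
  then have r: "t * (1 - t) * (\<eta> / 2 * (norm ?D)\<^sup>2 - ?c * (norm (?D - ?d))\<^sup>2) \<le> t * (1 - t) * (\<eta> * (norm ?d)\<^sup>2)"
    using assms by (intro mult_left_mono) auto
  have "moreau_envelope \<mu> g ?p \<le> g ?z + ?c * (norm (?z - ?p))\<^sup>2"
    by (rule moreau_envelope_le[OF lip \<mu>(1)])
  moreover have "g ?z \<le> (1 - t) * g za + t * g zb + t * (1 - t) * (\<eta> / 2 * (norm ?D)\<^sup>2)"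
    using weakly_convexD[OF assms(5-7), of za zb] by (simp only: mult_ac)
  ultimately have "moreau_envelope \<mu> g ?p \<le> (1 - t) * (g za + ?c * (norm (za - a))\<^sup>2)
      + t * (g zb + ?c * (norm (zb - b))\<^sup>2)
      + t * (1 - t) * (\<eta> / 2 * (norm ?D)\<^sup>2 - ?c * (norm (?D - ?d))\<^sup>2)"
    unfolding q by (simp only: right_diff_distrib distrib_left)
  also have "\<dots> \<le> (1 - t) * (moreau_envelope \<mu> g a + e) + t * (moreau_envelope \<mu> g b + e)
      + t * (1 - t) * (\<eta> * (norm ?d)\<^sup>2)"
    by (intro add_mono[OF add_mono[OF mult_left_mono mult_left_mono] r]) (use za zb assms in auto)
  finally show "moreau_envelope \<mu> g ?p \<le> (1 - t) * moreau_envelope \<mu> g a + t * moreau_envelope \<mu> g b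
      + \<eta> * (t * (1 - t)) * (norm ?d)\<^sup>2 + e"
    by (simp add: algebra_simps)
qed

subsection \<open>Subgradients\<close>

lemma regular_subdiff_realD:
  fixes F :: "'a::real_inner \<Rightarrow> real"
  assumes "w \<in> regular_subdiff (\<lambda>x. ereal (F x)) y" "e > 0"
  shows "\<forall>\<^sub>F x in at y. F y + w \<bullet> (x - y) - e * norm (x - y) \<le> F x"
proof -
  have "0 \<le> Liminf (at y) (\<lambda>x. (ereal (F x) - ereal (F y) - ereal (w \<bullet> (x - y))) / ereal (norm (x - y)))"
    using assms(1) unfolding regular_subdiff_def by simp
  then have "\<forall>\<^sub>F x in at y. ereal (- e) <
      (ereal (F x) - ereal (F y) - ereal (w \<bullet> (x - y))) / ereal (norm (x - y))"
    using \<open>e > 0\<close> unfolding le_Liminf_iff by (elim allE[of _ "ereal (- e)"]) simp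
  moreover have "\<forall>\<^sub>F x in at y. x \<noteq> y" by (rule eventually_neq_at_within)
  ultimately show ?thesis
  proof eventually_elim
    case (elim x)
    then have "- e < (F x - F y - w \<bullet> (x - y)) / norm (x - y)" by simp
    then have "- e * norm (x - y) < F x - F y - w \<bullet> (x - y)"
      using elim(2) by (subst (asm) pos_less_divide_eq) auto
    then show ?case by simp
  qed
qed

lemma regular_subdiffI:
  fixes J :: "'a::real_inner \<Rightarrow> ereal"
  assumes J: "J y = ereal c"
    and ev: "\<And>e. e > 0 \<Longrightarrow> \<forall>\<^sub>F x in at y. ereal (c + w \<bullet> (x - y) - e * norm (x - y)) \<le> J x"
  shows "w \<in> regular_subdiff J y"
proof -
  have "0 \<le> Liminf (at y) (\<lambda>x. (J x - J y - ereal (w \<bullet> (x - y))) / ereal (norm (x - y)))"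
    unfolding le_Liminf_iff
  proof (intro allI impI)
    fix b :: ereal assume "b < 0"
    then obtain z where z: "b < ereal z" "ereal z < 0" using ereal_dense2 by blast
    then have "- z > 0" by simp
    have "\<forall>\<^sub>F x in at y. x \<noteq> y" by (rule eventually_neq_at_within)
    with ev[OF \<open>- z > 0\<close>]
    show "\<forall>\<^sub>F x in at y. b < (J x - J y - ereal (w \<bullet> (x - y))) / ereal (norm (x - y))"
    proof eventually_elim
      case (elim x)
      show ?case
      proof (cases "J x")
        case (real j)
        have "z * norm (x - y) \<le> j - c - w \<bullet> (x - y)" using elim(1) real by simp
        then have "z \<le> (j - c - w \<bullet> (x - y)) / norm (x - y)"
          using elim(2) by (subst pos_le_divide_eq) auto
        then have "b < ereal ((j - c - w \<bullet> (x - y)) / norm (x - y))"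
          using order.strict_trans2[OF z(1)] by simp
        then show ?thesis using real J elim(2) by simp
      next
        case PInf
        then show ?thesis using z(1) J elim(2) by auto
      next
        case MInf
        then show ?thesis using elim(1) by simp
      qed
    qed
  qed
  then show ?thesis unfolding regular_subdiff_def edom_def using J by simp
qed

lemma regular_subdiff_subset_subdiff: "regular_subdiff J y \<subseteq> subdiff J y"
proof
  fix w assume w: "w \<in> regular_subdiff J y"
  then have "y \<in> edom J" unfolding regular_subdiff_def by simp
  moreover have "\<exists>x v. x \<longlonglongrightarrow> y \<and> (\<lambda>n. J (x n)) \<longlonglongrightarrow> J y \<and>
      (\<forall>n. v n \<in> regular_subdiff J (x n)) \<and> v \<longlonglongrightarrow> w"
    by (rule exI[of _ "\<lambda>_. y"], rule exI[of _ "\<lambda>_. w"]) (simp add: w)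
  ultimately show "w \<in> subdiff J y" unfolding subdiff_def by simp
qed

lemma nearly_convex_regular_subgradient:
  fixes F :: "'a::real_inner \<Rightarrow> real"
  assumes nc: "nearly_convex_on U e F" and "convex U" "u \<in> U" "y \<in> U" "e \<ge> 0"
    and w: "w \<in> regular_subdiff (\<lambda>x. ereal (F x)) y"
  shows "F y + w \<bullet> (u - y) - e * norm (u - y) \<le> F u"
proof (cases "u = y")
  case False
  then have n: "norm (u - y) > 0" by simp
  show ?thesis
  proof (rule field_le_epsilon)
    fix b :: real assume "b > 0"
    define e' where "e' = b / norm (u - y)"
    have e': "e' > 0" "e' * norm (u - y) = b" using \<open>b > 0\<close> n unfolding e'_def by auto
    obtain d where d: "d > 0" "\<And>x. x \<noteq> y \<Longrightarrow> dist x y < d \<Longrightarrow> F y + w \<bullet> (x - y) - e' * norm (x - y) \<le> F x"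
      using regular_subdiff_realD[OF w e'(1)] unfolding eventually_at by auto
    define t where "t = min (1 / 2) (d / (2 * norm (u - y)))"
    have t: "0 < t" "t < 1" using d n unfolding t_def by auto
    have "t \<le> d / (2 * norm (u - y))" unfolding t_def by simp
    then have td: "t * norm (u - y) < d" using n d(1) by (simp add: field_simps)
    let ?p = "(1 - t) *\<^sub>R y + t *\<^sub>R u"
    have p: "?p - y = t *\<^sub>R (u - y)" by (simp add: algebra_simps)
    then have np: "norm (?p - y) = t * norm (u - y)" using t by simp
    have "?p \<noteq> y"
    proof
      assume "?p = y"
      then have "norm (?p - y) = 0" by simp
      then show False unfolding np using t(1) n by simp
    qed
    moreover have "dist ?p y < d" unfolding dist_norm np by (rule td)
    ultimately have "F y + w \<bullet> (?p - y) - e' * norm (?p - y) \<le> F ?p" by (rule d(2))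
    then have "F y + w \<bullet> (t *\<^sub>R (u - y)) - e' * (t * norm (u - y)) \<le> F ?p"
      unfolding np unfolding p .
    then have "F y + t * (w \<bullet> (u - y)) - t * b \<le> F ?p"
      unfolding e'(2)[symmetric] by (simp add: mult_ac)
    also have "F ?p \<le> (1 - t) * F y + t * F u + t * (e * norm (u - y) * (1 - t))"
    proof -
      have "F ?p \<le> (1 - t) * F y + t * F u + e * (t * (1 - t)) * norm (u - y)"
        using nc assms(3,4) t unfolding nearly_convex_on_def by blast
      then show ?thesis by (simp add: mult_ac)
    qed
    also have "\<dots> \<le> (1 - t) * F y + t * F u + t * (e * norm (u - y))"
      using t n \<open>e \<ge> 0\<close> by (intro add_left_mono mult_left_mono mult_left_le) auto
    finally have "t * (F y + w \<bullet> (u - y) - e * norm (u - y)) \<le> t * (F u + b)"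
      by (simp add: algebra_simps)
    then show "F y + w \<bullet> (u - y) - e * norm (u - y) \<le> F u + b"
      using t by simp
  qed
qed auto

lemma nearly_convex_subgradient:
  fixes F :: "'a::real_inner \<Rightarrow> real"
  assumes nc: "nearly_convex_on U e F" and "convex U" "open U" "u \<in> U" "y \<in> U" "e \<ge> 0"
    and v: "v \<in> subdiff (\<lambda>x. ereal (F x)) y"
  shows "F y + v \<bullet> (u - y) - e * norm (u - y) \<le> F u"
proof -
  obtain x w where x: "x \<longlonglongrightarrow> y" "(\<lambda>n. F (x n)) \<longlonglongrightarrow> F y"
    "\<And>n. w n \<in> regular_subdiff (\<lambda>x. ereal (F x)) (x n)" "w \<longlonglongrightarrow> v"
    using v unfolding subdiff_def by auto
  have "\<forall>\<^sub>F n in sequentially. x n \<in> U"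
    using x(1) \<open>open U\<close> \<open>y \<in> U\<close> by (rule topological_tendstoD)
  then have "\<forall>\<^sub>F n in sequentially. F (x n) + w n \<bullet> (u - x n) - e * norm (u - x n) \<le> F u"
    by eventually_elim (rule nearly_convex_regular_subgradient[OF nc \<open>convex U\<close> \<open>u \<in> U\<close> _ \<open>e \<ge> 0\<close> x(3)])
  moreover have "(\<lambda>n. F (x n) + w n \<bullet> (u - x n) - e * norm (u - x n)) \<longlonglongrightarrow>
      F y + v \<bullet> (u - y) - e * norm (u - y)"
    by (intro tendsto_intros x)
  ultimately show ?thesis by (intro tendsto_upperbound) auto
qed

lemma subgradient_limit:
  fixes F :: "'a::euclidean_space \<Rightarrow> real"
  assumes F: "isCont F x0" and x: "x \<longlonglongrightarrow> x0"
    and unif: "\<And>e. e > 0 \<Longrightarrow> \<forall>\<^sub>F n in sequentially. \<forall>u. \<bar>Fn n u - F u\<bar> \<le> e"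
    and nc: "\<And>e. e > 0 \<Longrightarrow> \<exists>d>0. \<forall>\<^sub>F n in sequentially. nearly_convex_on (ball x0 d) e (Fn n)"
    and v: "\<And>n. v n \<in> subdiff (\<lambda>u. ereal (Fn n u)) (x n)"
  obtains r l where "strict_mono r" "(v \<circ> r) \<longlonglongrightarrow> l" "l \<in> regular_subdiff (\<lambda>u. ereal (F u)) x0"
proof -
  have near: "\<forall>\<^sub>F n in sequentially. x n \<in> ball x0 d" if "d > 0" for d
    using x that by (intro topological_tendstoD) auto
  have "Bseq v"
  proof -
    obtain d1 where d1: "d1 > 0" "\<forall>\<^sub>F n in sequentially. nearly_convex_on (ball x0 d1) 1 (Fn n)"
      using nc[of 1] by auto
    obtain d2 where d2: "d2 > 0" "\<And>u. dist u x0 < d2 \<Longrightarrow> dist (F u) (F x0) < 1"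
      using F by (metis continuous_at_eps_delta zero_less_one)
    define s where "s = min d1 d2 / 2"
    have s: "s > 0" "2 * s \<le> d1" "2 * s \<le> d2" using d1 d2 unfolding s_def by auto
    have "\<forall>\<^sub>F n in sequentially. norm (v n) \<le> (4 + s) / s"
      using near[OF s(1)] d1(2) unif[OF zero_less_one]
    proof eventually_elim
      case (elim n)
      show ?case
      proof (cases "v n = 0")
        case False
        define u where "u = x n + (s / norm (v n)) *\<^sub>R v n"
        have un: "norm (u - x n) = s" using False s unfolding u_def by simp
        have u: "dist u x0 < 2 * s"
          using dist_triangle[of u x0 "x n"] un elim(1) by (simp add: dist_norm norm_minus_commute)
        have "v n \<bullet> (u - x n) = s * norm (v n)"
          using False unfolding u_def by (simp add: power2_norm_eq_inner[symmetric] power2_eq_square)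
        moreover have "Fn n (x n) + v n \<bullet> (u - x n) - 1 * norm (u - x n) \<le> Fn n u"
          using u elim(1) s by (intro nearly_convex_subgradient[OF elim(2) _ _ _ _ _ v]) (auto simp: dist_commute)
        moreover have "\<bar>F u - F x0\<bar> < 1" "\<bar>F (x n) - F x0\<bar> < 1"
          using d2(2)[of u] d2(2)[of "x n"] u elim(1) s by (auto simp: dist_real_def dist_commute)
        moreover have "\<bar>Fn n u - F u\<bar> \<le> 1" "\<bar>Fn n (x n) - F (x n)\<bar> \<le> 1" using elim(3) by auto
        ultimately have "s * norm (v n) \<le> 4 + s" using un by linarith
        then show ?thesis using s by (simp add: pos_le_divide_eq mult.commute)
      qed (use s in auto)
    qed
    then show ?thesis by (rule BfunI)
  qed
  then obtain l r where r: "strict_mono r" "(v \<circ> r) \<longlonglongrightarrow> l"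
    using bounded_imp_convergent_subsequence unfolding Bseq_eq_bounded by blast
  have unif': "\<forall>\<^sub>F n in sequentially. \<forall>u. \<bar>Fn (r n) u - F u\<bar> \<le> e" if "e > 0" for e
    using eventually_subseq[OF r(1) unif[OF that]] .
  have lim: "(\<lambda>n. Fn (r n) (y n)) \<longlonglongrightarrow> F u" if y: "y \<longlonglongrightarrow> u" and "isCont F u \<or> (\<forall>n. y n = u)" for y u
  proof -
    have "(\<lambda>n. Fn (r n) (y n) - F (y n)) \<longlonglongrightarrow> 0"
    proof (rule tendstoI)
      fix e :: real assume "e > 0"
      then have "e / 2 > 0" by simp
      from unif'[OF this] show "\<forall>\<^sub>F n in sequentially. dist (Fn (r n) (y n) - F (y n)) 0 < e"
      proof eventually_elim
        case (elim n)
        from elim[THEN spec, of "y n"] show ?case using \<open>e > 0\<close> by simp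
      qed
    qed
    moreover have "(\<lambda>n. F (y n)) \<longlonglongrightarrow> F u"
      using that by (auto intro: isCont_tendsto_compose)
    ultimately show ?thesis using tendsto_add[of "\<lambda>n. Fn (r n) (y n) - F (y n)" 0] by fastforce
  qed
  have xr: "(\<lambda>n. x (r n)) \<longlonglongrightarrow> x0" and vr: "(\<lambda>n. v (r n)) \<longlonglongrightarrow> l"
    using LIMSEQ_subseq_LIMSEQ[OF x r(1)] r(2) by (auto simp: o_def)
  have "l \<in> regular_subdiff (\<lambda>u. ereal (F u)) x0"
  proof (rule regular_subdiffI[OF refl])
    fix e :: real assume "e > 0"
    obtain d where d: "d > 0" "\<forall>\<^sub>F n in sequentially. nearly_convex_on (ball x0 d) e (Fn n)"
      using nc[OF \<open>e > 0\<close>] by auto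
    have "F x0 + l \<bullet> (u - x0) - e * norm (u - x0) \<le> F u" if u: "u \<in> ball x0 d" for u
    proof (rule tendsto_le[OF sequentially_bot])
      show "(\<lambda>n. Fn (r n) u) \<longlonglongrightarrow> F u" by (rule lim) auto
      show "(\<lambda>n. Fn (r n) (x (r n)) + v (r n) \<bullet> (u - x (r n)) - e * norm (u - x (r n))) \<longlonglongrightarrow>
        F x0 + l \<bullet> (u - x0) - e * norm (u - x0)"
        by (intro tendsto_intros lim xr vr) (use F in auto)
      show "\<forall>\<^sub>F n in sequentially. Fn (r n) (x (r n)) + v (r n) \<bullet> (u - x (r n)) - e * norm (u - x (r n)) \<le> Fn (r n) u"
        using eventually_subseq[OF r(1) d(2)] eventually_subseq[OF r(1) near[OF d(1)]]
      proof eventually_elim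
        case (elim n)
        then show ?case
          using u \<open>e > 0\<close> v by (intro nearly_convex_subgradient[where U = "ball x0 d"]) auto
      qed
    qed
    then show "\<forall>\<^sub>F u in at x0. ereal (F x0 + l \<bullet> (u - x0) - e * norm (u - x0)) \<le> ereal (F u)"
      unfolding eventually_at using d(1) by (auto simp: dist_commute)
  qed
  with r that show ?thesis by blast
qed

subsection \<open>The proximity operator\<close>

lemma lsc_le_limit:
  assumes "lsc J" "y \<longlonglongrightarrow> l" "(\<lambda>n. J (y n)) \<longlonglongrightarrow> c"
  shows "J l \<le> c"
proof (rule ccontr)
  assume "\<not> J l \<le> c"
  then obtain d where d: "c < d" "d < J l" using dense[of c "J l"] by (auto simp: not_le)
  then have "d < Liminf (at l) J" using \<open>lsc J\<close> unfolding lsc_def by (meson order.strict_trans2)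
  then have "\<forall>\<^sub>F u in at l. d < J u" by (rule less_LiminfD)
  then have "\<forall>\<^sub>F u in nhds l. d < J u"
    using d(2) unfolding eventually_at_filter by (auto elim: eventually_mono)
  then have "\<forall>\<^sub>F n in sequentially. d < J (y n)"
    using assms(2) unfolding filterlim_def le_filter_def eventually_filtermap by blast
  moreover have "\<forall>\<^sub>F n in sequentially. J (y n) < d" using assms(3) d(1) by (rule order_tendstoD)
  ultimately have "\<forall>\<^sub>F n in sequentially. False" by eventually_elim auto
  then show False by simp
qed

lemma lsc_attains_min:
  fixes J :: "'a::metric_space \<Rightarrow> ereal"
  assumes J: "lsc J" and q: "continuous_on UNIV q" and K: "compact K" "K \<noteq> {}"
  obtains z where "z \<in> K" "\<And>x. x \<in> K \<Longrightarrow> J z + ereal (q z) \<le> J x + ereal (q x)"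
proof -
  let ?P = "\<lambda>x. J x + ereal (q x)"
  define c where "c = (INF x\<in>K. ?P x)"
  obtain p where p: "\<And>n. p n \<in> ?P ` K" "p \<longlonglongrightarrow> c"
    using Inf_as_limit[of "?P ` K"] K(2) unfolding c_def by blast
  from p(1) have "\<forall>n. \<exists>x\<in>K. p n = ?P x" by blast
  then obtain y where y: "\<And>n. y n \<in> K" "\<And>n. p n = ?P (y n)" by metis
  obtain l r where lr: "l \<in> K" "strict_mono r" "(y \<circ> r) \<longlonglongrightarrow> l"
    using K(1) y(1) unfolding compact_def by blast
  then have yl: "(\<lambda>n. y (r n)) \<longlonglongrightarrow> l" by (simp add: o_def)
  have "(\<lambda>n. ereal (q (y (r n)))) \<longlonglongrightarrow> ereal (q l)"
    using isCont_tendsto_compose[OF _ yl, of q] q by (auto simp: continuous_on_eq_continuous_at)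
  moreover have "(\<lambda>n. ?P (y (r n))) \<longlonglongrightarrow> c"
    using LIMSEQ_subseq_LIMSEQ[OF p(2) lr(2)] y(2) by (simp add: o_def)
  ultimately have "(\<lambda>n. ?P (y (r n)) - ereal (q (y (r n)))) \<longlonglongrightarrow> c - ereal (q l)"
    by (intro tendsto_diff_ereal_general) auto
  moreover have "?P (y (r n)) - ereal (q (y (r n))) = J (y (r n))" for n
    by (cases "J (y (r n))") auto
  ultimately have "J l \<le> c - ereal (q l)" using lsc_le_limit[OF J yl] by simp
  then have "?P l \<le> c" by (cases "J l"; cases c) auto
  then have "?P l \<le> ?P x" if "x \<in> K" for x
    using that unfolding c_def by (meson INF_lower order_trans)
  with lr(1) that show ?thesis by blast
qed

lemma econvex_realD:
  assumes "econvex J" "J x = ereal a" "J y = ereal b" "0 < t" "t < 1"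
  shows "J ((1 - t) *\<^sub>R x + t *\<^sub>R y) \<le> ereal ((1 - t) * a + t * b)"
proof -
  have "J ((1 - t) *\<^sub>R x + t *\<^sub>R y) \<le> ereal (1 - t) * J x + ereal t * J y"
    using assms(1,4,5) unfolding econvex_def by blast
  then show ?thesis using assms(2,3) by simp
qed

text \<open>Outside the unit ball around \<open>x0\<close>, convexity keeps \<open>\<phi>\<close> above the cone with apex
  \<open>(x0, \<phi> x0)\<close> that has the minimum of \<open>\<phi>\<close> over the ball as its value on the unit sphere.\<close>

lemma convex_linear_lower_bound:
  fixes \<phi> :: "'a::euclidean_space \<Rightarrow> ereal"
  assumes phi: "proper \<phi>" "lsc \<phi>" "econvex \<phi>" and x0: "\<phi> x0 = ereal c"
  obtains m where "m \<le> c" "\<And>x. ereal (m - (c - m) * norm (x - x0)) \<le> \<phi> x"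
proof -
  obtain z where z: "z \<in> cball x0 1" "\<And>x. x \<in> cball x0 1 \<Longrightarrow> \<phi> z \<le> \<phi> x"
    using lsc_attains_min[OF phi(2), of "\<lambda>_. 0" "cball x0 1"] by (auto simp flip: zero_ereal_def)
  have "\<phi> z \<le> ereal c" using z(2)[of x0] x0 by simp
  moreover have "\<phi> z \<noteq> -\<infinity>" using phi(1) unfolding proper_def by auto
  ultimately obtain m where m: "\<phi> z = ereal m" "m \<le> c" by (cases "\<phi> z") auto
  have "ereal (m - (c - m) * norm (x - x0)) \<le> \<phi> x" for x
  proof (cases "norm (x - x0) \<le> 1")
    case True
    then have "ereal m \<le> \<phi> x" using z(2)[of x] m by (simp add: dist_norm norm_minus_commute)
    moreover have "ereal (m - (c - m) * norm (x - x0)) \<le> ereal m" using m by simp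
    ultimately show ?thesis by (rule order_trans[rotated])
  next
    case False
    define r where "r = norm (x - x0)"
    have r: "r > 1" using False unfolding r_def by simp
    show ?thesis
    proof (cases "\<phi> x")
      case (real b)
      have t: "0 < 1 / r" "1 / r < 1" using r by auto
      have "(1 - 1 / r) *\<^sub>R x0 + (1 / r) *\<^sub>R x - x0 = (1 / r) *\<^sub>R (x - x0)"
        by (simp add: algebra_simps)
      then have "norm ((1 - 1 / r) *\<^sub>R x0 + (1 / r) *\<^sub>R x - x0) = 1"
        using r by (simp add: r_def[symmetric])
      then have "ereal m \<le> \<phi> ((1 - 1 / r) *\<^sub>R x0 + (1 / r) *\<^sub>R x)"
        using z(2) m by (simp add: dist_norm norm_minus_commute)
      also have "\<dots> \<le> ereal ((1 - 1 / r) * c + 1 / r * b)"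
        by (rule econvex_realD[OF phi(3) x0 real t])
      finally have "r * m \<le> (r - 1) * c + b" using r by (simp add: field_simps)
      then have "m - (c - m) * r \<le> b" using m(2) by (simp add: algebra_simps)
      then show ?thesis using real r_def by simp
    next
      case MInf
      then show ?thesis using phi(1) unfolding proper_def by auto
    qed auto
  qed
  with m(2) that show ?thesis by blast
qed

lemma prox_minimizes:
  fixes \<phi> :: "'a::euclidean_space \<Rightarrow> ereal"
  assumes phi: "proper \<phi>" "lsc \<phi>" "econvex \<phi>" and "\<gamma> > 0"
  shows "\<phi> (prox \<gamma> \<phi> a) + ereal (1 / (2 * \<gamma>) * (norm (prox \<gamma> \<phi> a - a))\<^sup>2)
    \<le> \<phi> u + ereal (1 / (2 * \<gamma>) * (norm (u - a))\<^sup>2)"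
proof -
  let ?q = "\<lambda>x. 1 / (2 * \<gamma>) * (norm (x - a))\<^sup>2"
  let ?P = "\<lambda>x. \<phi> x + ereal (?q x)"
  obtain x0 c where x0: "\<phi> x0 = ereal c"
    using phi(1) unfolding proper_def edom_def by (auto simp: less_ereal.simps) (metis ereal_cases)
  obtain m where m: "m \<le> c" "\<And>x. ereal (m - (c - m) * norm (x - x0)) \<le> \<phi> x"
    using convex_linear_lower_bound[OF phi x0] by blast
  define D where "D = norm (x0 - a)"
  define A where "A = c - m"
  define R where "R = 1 + 2 * D + 4 * \<gamma> * A"
  have AD: "A \<ge> 0" "D \<ge> 0" using m unfolding A_def D_def by auto
  have "R \<ge> 1 + 2 * D" using AD \<open>\<gamma> > 0\<close> unfolding R_def by simp
  obtain z where z: "z \<in> cball x0 R" "\<And>x. x \<in> cball x0 R \<Longrightarrow> ?P z \<le> ?P x"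
  proof (rule lsc_attains_min[OF phi(2), of ?q "cball x0 R"])
    show "continuous_on UNIV ?q" using \<open>\<gamma> > 0\<close> by (auto intro!: continuous_intros)
    show "cball x0 R \<noteq> {}" using \<open>R \<ge> 1 + 2 * D\<close> AD by simp
  qed auto
  have "?P z \<le> ?P x" for x
  proof (cases "x \<in> cball x0 R")
    case False
    define r where "r = norm (x - x0)"
    have r: "r > R" using False unfolding r_def by (simp add: dist_norm norm_minus_commute)
    have r1: "r \<ge> 1" "r \<ge> 2 * D" using r AD \<open>R \<ge> 1 + 2 * D\<close> by auto
    have "r - D \<le> norm (x - a)"
      unfolding r_def D_def using norm_triangle_ineq4[of "x - a" "x0 - a"] by (simp add: algebra_simps)
    then have "(r - D)\<^sup>2 \<le> (norm (x - a))\<^sup>2" using r1 AD by (intro power_mono) auto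
    moreover have "2 * \<gamma> * (A + A * r) \<le> r * (r - 2 * D)"
    proof -
      have "A \<le> A * r" using AD r1 by (simp add: mult_left_le mult_le_cancel_left1)
      then have "2 * \<gamma> * (A + A * r) \<le> 2 * \<gamma> * (A * r + A * r)"
        using \<open>\<gamma> > 0\<close> by (intro mult_left_mono) auto
      also have "\<dots> = r * (4 * \<gamma> * A)" by (simp add: algebra_simps)
      also have "\<dots> \<le> r * (r - 2 * D)" using r r1 unfolding R_def by (intro mult_left_mono) auto
      finally show ?thesis .
    qed
    moreover have "(r - D)\<^sup>2 = r * (r - 2 * D) + D\<^sup>2" by (simp add: power2_eq_square algebra_simps)
    ultimately have "2 * \<gamma> * (A + A * r) + D\<^sup>2 \<le> (norm (x - a))\<^sup>2" by simp
    from divide_right_mono[OF this, of "2 * \<gamma>"] have "A + A * r + 1 / (2 * \<gamma>) * D\<^sup>2 \<le> ?q x"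
      using \<open>\<gamma> > 0\<close> by (simp add: add_divide_distrib)
    then have "c + ?q x0 \<le> (m - (c - m) * r) + ?q x"
      unfolding A_def D_def[symmetric] by simp
    then have "?P x0 \<le> ereal (m - (c - m) * norm (x - x0)) + ereal (?q x)"
      using x0 unfolding r_def by simp
    also have "\<dots> \<le> ?P x" by (intro add_right_mono m(2))
    finally have "?P x0 \<le> ?P x" .
    moreover have "?P z \<le> ?P x0" using z(2)[of x0] \<open>R \<ge> 1 + 2 * D\<close> AD by auto
    ultimately show ?thesis by (rule order_trans[rotated])
  qed (use z in auto)
  then have "is_arg_min ?P (\<lambda>_. True) z" by (simp add: is_arg_min_linorder)
  then have "is_arg_min ?P (\<lambda>_. True) (prox \<gamma> \<phi> a)"
    unfolding prox_def arg_min_def by (rule someI)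
  then show ?thesis by (simp add: is_arg_min_linorder)
qed

lemma prox_in_edom:
  fixes \<phi> :: "'a::euclidean_space \<Rightarrow> ereal"
  assumes phi: "proper \<phi>" "lsc \<phi>" "econvex \<phi>" and "\<gamma> > 0"
  obtains c where "\<phi> (prox \<gamma> \<phi> a) = ereal c"
proof -
  obtain x0 where "\<phi> x0 < \<infinity>" using phi(1) unfolding proper_def edom_def by auto
  then have "\<phi> (prox \<gamma> \<phi> a) \<noteq> \<infinity>"
    using prox_minimizes[OF assms, of a x0] by auto
  moreover have "\<phi> (prox \<gamma> \<phi> a) \<noteq> -\<infinity>" using phi(1) unfolding proper_def by auto
  ultimately show ?thesis using that by (cases "\<phi> (prox \<gamma> \<phi> a)") auto
qed

text \<open>Comparing with the midpoint instead of using strong convexity costs a factor 2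
  in the Lipschitz constant, which is harmless for continuity.\<close>

lemma prox_lipschitz:
  fixes \<phi> :: "'a::euclidean_space \<Rightarrow> ereal"
  assumes phi: "proper \<phi>" "lsc \<phi>" "econvex \<phi>" and "\<gamma> > 0"
  shows "2-lipschitz_on UNIV (prox \<gamma> \<phi>)"
proof (rule lipschitz_onI)
  fix a b :: 'a
  define p where "p = prox \<gamma> \<phi> a"
  define q where "q = prox \<gamma> \<phi> b"
  obtain cp where cp: "\<phi> p = ereal cp" using prox_in_edom[OF assms] unfolding p_def by blast
  obtain cq where cq: "\<phi> q = ereal cq" using prox_in_edom[OF assms] unfolding q_def by blast
  define m where "m = (1 - 1 / 2) *\<^sub>R p + (1 / 2 :: real) *\<^sub>R q"
  have m: "\<phi> m \<le> ereal ((1 - 1 / 2) * cp + 1 / 2 * cq)"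
    unfolding m_def by (rule econvex_realD[OF phi(3) cp cq]) auto
  moreover have "\<phi> m \<noteq> -\<infinity>" using phi(1) unfolding proper_def by auto
  ultimately obtain cm where cm: "\<phi> m = ereal cm" "cm \<le> (cp + cq) / 2"
    by (cases "\<phi> m") auto
  have mid: "(norm (m - d))\<^sup>2 = (norm (p - d))\<^sup>2 / 2 + (norm (q - d))\<^sup>2 / 2 - (norm (p - q))\<^sup>2 / 4" for d
  proof -
    have "m - d = (1 - 1 / 2) *\<^sub>R (p - d) + (1 / 2) *\<^sub>R (q - d)"
      unfolding m_def by (simp add: algebra_simps flip: scaleR_left.add)
    then show ?thesis using norm_sq_convex_combination[of "1 / 2" "p - d" "q - d"] by simp
  qed
  have "cp + 1 / (2 * \<gamma>) * (norm (p - a))\<^sup>2 \<le> cm + 1 / (2 * \<gamma>) * (norm (m - a))\<^sup>2"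
    using prox_minimizes[OF assms, of a m] cm cp unfolding p_def by simp
  from mult_left_mono[OF this, of "2 * \<gamma>"]
  have a: "2 * \<gamma> * cp + (norm (p - a))\<^sup>2 \<le> 2 * \<gamma> * cm + (norm (m - a))\<^sup>2"
    using \<open>\<gamma> > 0\<close> by (simp add: distrib_left)
  have "cq + 1 / (2 * \<gamma>) * (norm (q - b))\<^sup>2 \<le> cm + 1 / (2 * \<gamma>) * (norm (m - b))\<^sup>2"
    using prox_minimizes[OF assms, of b m] cm cq unfolding q_def by simp
  from mult_left_mono[OF this, of "2 * \<gamma>"]
  have b: "2 * \<gamma> * cq + (norm (q - b))\<^sup>2 \<le> 2 * \<gamma> * cm + (norm (m - b))\<^sup>2"
    using \<open>\<gamma> > 0\<close> by (simp add: distrib_left)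
  have "2 * \<gamma> * cm \<le> \<gamma> * cp + \<gamma> * cq"
    using mult_left_mono[OF cm(2), of "2 * \<gamma>"] \<open>\<gamma> > 0\<close> by (simp add: distrib_left)
  with a b have "(norm (p - q))\<^sup>2 \<le> (norm (q - a))\<^sup>2 - (norm (p - a))\<^sup>2 + (norm (p - b))\<^sup>2 - (norm (q - b))\<^sup>2"
    unfolding mid by argo
  also have "\<dots> = 2 * ((p - q) \<bullet> (a - b))"
    by (simp add: power2_norm_eq_inner inner_diff_left inner_diff_right inner_commute)
  also have "\<dots> \<le> 2 * (norm (p - q) * norm (a - b))" using norm_cauchy_schwarz by auto
  finally have "norm (p - q) * norm (p - q) \<le> norm (p - q) * (2 * norm (a - b))"
    by (simp add: power2_eq_square)
  then have "norm (p - q) \<le> 2 * norm (a - b)"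
    by (cases "p = q") (auto simp: mult_le_cancel_left_pos)
  then show "dist (prox \<gamma> \<phi> a) (prox \<gamma> \<phi> b) \<le> 2 * dist a b"
    unfolding p_def q_def by (simp add: dist_norm)
qed simp

lemma prox_subgradient:
  fixes \<phi> :: "'a::euclidean_space \<Rightarrow> ereal"
  assumes phi: "proper \<phi>" "lsc \<phi>" "econvex \<phi>" and "\<gamma> > 0"
    and fix_x: "prox \<gamma> \<phi> (x - \<gamma> *\<^sub>R v) = x" and c: "\<phi> x = ereal c"
  shows "ereal (c - v \<bullet> (u - x) - 1 / (2 * \<gamma>) * (norm (u - x))\<^sup>2) \<le> \<phi> u"
proof (cases "\<phi> u")
  case (real b)
  have "c + 1 / (2 * \<gamma>) * (norm (\<gamma> *\<^sub>R v))\<^sup>2 \<le> b + 1 / (2 * \<gamma>) * (norm ((u - x) + \<gamma> *\<^sub>R v))\<^sup>2"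
    using prox_minimizes[OF phi \<open>\<gamma> > 0\<close>, of "x - \<gamma> *\<^sub>R v" u] real c unfolding fix_x by (simp add: algebra_simps)
  also have "(norm ((u - x) + \<gamma> *\<^sub>R v))\<^sup>2 = (norm (u - x))\<^sup>2 + 2 * \<gamma> * (v \<bullet> (u - x)) + (norm (\<gamma> *\<^sub>R v))\<^sup>2"
    unfolding power2_norm_eq_inner by (simp add: inner_add_left inner_add_right inner_commute algebra_simps)
  finally have "c \<le> b + v \<bullet> (u - x) + 1 / (2 * \<gamma>) * (norm (u - x))\<^sup>2"
    using \<open>\<gamma> > 0\<close> by (simp add: distrib_left add_divide_distrib)
  then show ?thesis using real by simp
next
  case MInf
  then show ?thesis using phi(1) unfolding proper_def by auto
qed auto

subsection \<open>The stationarity measure\<close>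

lemma stat_measure_nonneg:
  assumes "\<gamma> > 0"
  shows "0 \<le> stat_measure \<gamma> F \<phi> x"
  using assms unfolding stat_measure_def by (intro INF_greatest) auto

lemma stat_measure_le:
  assumes "v \<in> subdiff (\<lambda>u. ereal (F u)) x"
  shows "stat_measure \<gamma> F \<phi> x \<le> ereal (inverse \<gamma> * norm (x - prox \<gamma> \<phi> (x - \<gamma> *\<^sub>R v)))"
  unfolding stat_measure_def by (rule INF_lower[OF assms])

lemma stat_measure_liminf_attained:
  fixes F :: "'a::euclidean_space \<Rightarrow> real"
  assumes phi: "proper \<phi>" "lsc \<phi>" "econvex \<phi>" and "\<gamma> > 0"
    and F: "isCont F x0" and x: "x \<longlonglongrightarrow> x0"
    and unif: "\<And>e. e > 0 \<Longrightarrow> \<forall>\<^sub>F n in sequentially. \<forall>u. \<bar>Fn n u - F u\<bar> \<le> e"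
    and nc: "\<And>e. e > 0 \<Longrightarrow> \<exists>d>0. \<forall>\<^sub>F n in sequentially. nearly_convex_on (ball x0 d) e (Fn n)"
    and fin: "liminf (\<lambda>n. stat_measure \<gamma> (Fn n) \<phi> (x n)) < \<infinity>"
  obtains l where "l \<in> regular_subdiff (\<lambda>u. ereal (F u)) x0"
    "ereal (inverse \<gamma> * norm (x0 - prox \<gamma> \<phi> (x0 - \<gamma> *\<^sub>R l))) \<le> liminf (\<lambda>n. stat_measure \<gamma> (Fn n) \<phi> (x n))"
proof -
  let ?M = "\<lambda>n. stat_measure \<gamma> (Fn n) \<phi> (x n)"
  let ?res = "\<lambda>y v. inverse \<gamma> * norm (y - prox \<gamma> \<phi> (y - \<gamma> *\<^sub>R v))"
  have "0 \<le> liminf ?M" by (intro Liminf_bounded always_eventually allI stat_measure_nonneg \<open>\<gamma> > 0\<close>)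
  then obtain L where L: "liminf ?M = ereal L" using fin by (cases "liminf ?M") auto
  have "\<exists>N v. k < N \<and> v \<in> subdiff (\<lambda>u. ereal (Fn N u)) (x N) \<and> ?res (x N) v < L + inverse (real (Suc k))" for k
  proof -
    have "liminf ?M < ereal (L + inverse (real (Suc k)))" unfolding L by simp
    then obtain N where N: "k < N" "?M N < ereal (L + inverse (real (Suc k)))"
      using liminf_upper_bound by blast
    then show ?thesis unfolding stat_measure_def INF_less_iff by auto
  qed
  then obtain n v where nv: "\<And>k. k < n k" "\<And>k. v k \<in> subdiff (\<lambda>u. ereal (Fn (n k) u)) (x (n k))"
    "\<And>k. ?res (x (n k)) (v k) < L + inverse (real (Suc k))"
    by metis
  have n: "filterlim n sequentially sequentially"
    by (rule filterlim_at_top_mono[OF filterlim_ident]) (simp add: nv(1) less_imp_le always_eventually)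
  have xn: "(\<lambda>k. x (n k)) \<longlonglongrightarrow> x0" by (rule filterlim_compose[OF x n])
  obtain r l where r: "strict_mono r" "(v \<circ> r) \<longlonglongrightarrow> l" "l \<in> regular_subdiff (\<lambda>u. ereal (F u)) x0"
  proof (rule subgradient_limit[OF F xn, of "\<lambda>k. Fn (n k)" v])
    show "\<forall>\<^sub>F k in sequentially. \<forall>u. \<bar>Fn (n k) u - F u\<bar> \<le> e" if "e > 0" for e
      using eventually_compose_filterlim[OF unif[OF that] n] .
    show "\<exists>d>0. \<forall>\<^sub>F k in sequentially. nearly_convex_on (ball x0 d) e (Fn (n k))" if "e > 0" for e
      using nc[OF that] eventually_compose_filterlim[OF _ n] by blast
  qed (use nv in auto)
  have prox_cont: "isCont (prox \<gamma> \<phi>) a" for a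
    using lipschitz_on_continuous_on[OF prox_lipschitz[OF phi \<open>\<gamma> > 0\<close>]]
    by (simp add: continuous_on_eq_continuous_at)
  have xr: "(\<lambda>k. x (n (r k))) \<longlonglongrightarrow> x0" and vr: "(\<lambda>k. v (r k)) \<longlonglongrightarrow> l"
    using LIMSEQ_subseq_LIMSEQ[OF xn r(1)] r(2) by (auto simp: o_def)
  have "?res x0 l \<le> L + 0"
  proof (rule tendsto_le[OF sequentially_bot])
    show "(\<lambda>k. ?res (x (n (r k))) (v (r k))) \<longlonglongrightarrow> ?res x0 l"
      by (intro tendsto_intros xr vr isCont_tendsto_compose[OF prox_cont])
    show "(\<lambda>k. L + inverse (real (Suc (r k)))) \<longlonglongrightarrow> L + 0"
      using LIMSEQ_subseq_LIMSEQ[OF LIMSEQ_inverse_real_of_nat r(1)]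
      by (intro tendsto_intros) (simp add: o_def)
    show "\<forall>\<^sub>F k in sequentially. ?res (x (n (r k))) (v (r k)) \<le> L + inverse (real (Suc (r k)))"
      using nv(3) less_imp_le by (intro always_eventually) blast
  qed
  then show ?thesis using that r(3) L by simp
qed

lemma prox_fixed_point_stationary:
  fixes \<phi> :: "'a::euclidean_space \<Rightarrow> ereal"
  assumes phi: "proper \<phi>" "lsc \<phi>" "econvex \<phi>" and "\<gamma> > 0"
    and v: "v \<in> regular_subdiff (\<lambda>u. ereal (f u)) x" and fix_x: "prox \<gamma> \<phi> (x - \<gamma> *\<^sub>R v) = x"
  shows "stationary_point (\<lambda>u. ereal (f u) + \<phi> u) x"
proof -
  obtain c where c: "\<phi> x = ereal c" using prox_in_edom[OF phi \<open>\<gamma> > 0\<close>] fix_x by metis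
  have "0 \<in> regular_subdiff (\<lambda>u. ereal (f u) + \<phi> u) x"
  proof (rule regular_subdiffI)
    show "ereal (f x) + \<phi> x = ereal (f x + c)" using c by simp
    fix e :: real assume "e > 0"
    then have e2: "e / 2 > 0" by simp
    have "\<forall>\<^sub>F u in at x. dist u x < e * \<gamma>"
      unfolding eventually_at using \<open>e > 0\<close> \<open>\<gamma> > 0\<close> by (intro exI[of _ "e * \<gamma>"]) auto
    with regular_subdiff_realD[OF v e2]
    show "\<forall>\<^sub>F u in at x. ereal (f x + c + 0 \<bullet> (u - x) - e * norm (u - x)) \<le> ereal (f u) + \<phi> u"
    proof eventually_elim
      case (elim u)
      have "norm (u - x) * norm (u - x) \<le> e * \<gamma> * norm (u - x)"
        using elim(2) by (intro mult_right_mono) (auto simp: dist_norm)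
      from divide_right_mono[OF this, of "2 * \<gamma>"]
      have "1 / (2 * \<gamma>) * (norm (u - x))\<^sup>2 \<le> e / 2 * norm (u - x)"
        using \<open>\<gamma> > 0\<close> by (simp add: power2_eq_square)
      with elim(1) have "f x + c - e * norm (u - x) \<le>
          f u + (c - v \<bullet> (u - x) - 1 / (2 * \<gamma>) * (norm (u - x))\<^sup>2)"
        by (simp add: algebra_simps)
      then have "ereal (f x + c - e * norm (u - x)) \<le>
          ereal (f u) + ereal (c - v \<bullet> (u - x) - 1 / (2 * \<gamma>) * (norm (u - x))\<^sup>2)" by simp
      also have "\<dots> \<le> ereal (f u) + \<phi> u"
        by (intro add_left_mono prox_subgradient[OF phi \<open>\<gamma> > 0\<close> fix_x c])
      finally show ?case by simp
    qed
  qed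
  then show ?thesis unfolding stationary_point_def using regular_subdiff_subset_subdiff by blast
qed

theorem mainTheorem1:
  fixes \<phi> :: "'a::euclidean_space \<Rightarrow> ereal"
    and h :: "'a \<Rightarrow> real" and gradh :: "'a \<Rightarrow> 'a"
    and S :: "'a \<Rightarrow> 'b::euclidean_space"
    and g :: "'b \<Rightarrow> real" and \<eta> :: real
    and f :: "'a \<Rightarrow> real"
    and xbar :: 'a and x :: "nat \<Rightarrow> 'a"
  assumes phi: "proper \<phi>" "lsc \<phi>" "econvex \<phi>"
    and h_diff: "\<And>u. GDERIV h u :> gradh u"
    and h_lipschitz: "\<exists>L. L-lipschitz_on (edom \<phi>) gradh"
    and h_cont: "isCont gradh xbar"
    and S: "C1_map S"
    and g_lipschitz: "\<exists>L. L-lipschitz_on UNIV g"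
    and g_weakly_convex: "\<eta> > 0" "weakly_convex \<eta> g"
    and f: "f = (\<lambda>u. h u + g (S u))"
    and bounded_below: "(INF u \<in> edom \<phi>. ereal (f u) + \<phi> u) > -\<infinity>"
    and x: "x \<longlonglongrightarrow> xbar"
  shows "(\<forall>\<gamma>>0. liminf (\<lambda>n. stat_measure \<gamma> f \<phi> (x n)) \<ge> stat_measure \<gamma> f \<phi> xbar) \<and>
    (\<forall>\<mu> :: nat \<Rightarrow> real. \<forall>fn :: nat \<Rightarrow> 'a \<Rightarrow> real.
       (\<forall>n. 0 < \<mu> n \<and> \<mu> n < inverse \<eta>) \<and> decseq \<mu> \<and> \<mu> \<longlonglongrightarrow> 0 \<and>
       (\<forall>n. fn n = (\<lambda>u. h u + moreau_envelope (\<mu> n) g (S u))) \<longrightarrow>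
       (\<forall>\<gamma>>0. liminf (\<lambda>n. stat_measure \<gamma> (fn n) \<phi> (x n)) \<ge> stat_measure \<gamma> f \<phi> xbar) \<and>
       ((\<exists>\<gamma>>0. liminf (\<lambda>n. stat_measure \<gamma> (fn n) \<phi> (x n)) = 0) \<longrightarrow>
          stationary_point (\<lambda>u. ereal (f u) + \<phi> u) xbar))"
proof -
  obtain K where lip: "K-lipschitz_on UNIV g" using g_lipschitz by blast
  then have K: "K \<ge> 0" by (rule lipschitz_on_nonneg)
  have "isCont h u" for u using h_diff[of u] unfolding gderiv_def by (rule has_derivative_continuous)
  moreover have "isCont S u" for u using S unfolding C1_map_def by (meson has_derivative_continuous)
  moreover have "isCont g z" for z
    using lipschitz_on_continuous_on[OF lip] by (simp add: continuous_on_eq_continuous_at)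
  ultimately have f_cont: "isCont f xbar" unfolding f by (intro continuous_intros isCont_o2[of xbar S g])
  have nc: "\<exists>d>0. \<forall>G. (K-lipschitz_on UNIV G \<and>
     (\<forall>a b t. 0 < t \<and> t < 1 \<longrightarrow> G ((1 - t) *\<^sub>R a + t *\<^sub>R b) \<le>
        (1 - t) * G a + t * G b + \<eta> * (t * (1 - t)) * (norm (a - b))\<^sup>2)) \<longrightarrow>
     nearly_convex_on (ball xbar d) e (\<lambda>u. h u + G (S u))" if "e > 0" for e
    using nearly_convex_composite[OF h_diff h_cont S K _ that] g_weakly_convex(1) by simp
  have g_wc: "g ((1 - t) *\<^sub>R a + t *\<^sub>R b) \<le>
        (1 - t) * g a + t * g b + \<eta> * (t * (1 - t)) * (norm (a - b))\<^sup>2" if "0 < t \<and> t < 1" for a b t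
  proof -
    have "\<eta> / 2 * (t * (1 - t)) * (norm (a - b))\<^sup>2 \<le> \<eta> * (t * (1 - t)) * (norm (a - b))\<^sup>2"
      using that g_weakly_convex(1) by (intro mult_right_mono) auto
    then show ?thesis using weakly_convexD[OF g_weakly_convex(2), of t a b] that by linarith
  qed
  have lower: "stat_measure \<gamma> f \<phi> xbar \<le> liminf (\<lambda>n. stat_measure \<gamma> (Fn n) \<phi> (x n))"
    if "\<gamma> > 0" and unif: "\<And>e. e > 0 \<Longrightarrow> \<forall>\<^sub>F n in sequentially. \<forall>u. \<bar>Fn n u - f u\<bar> \<le> e"
      and Fn: "\<And>e. e > 0 \<Longrightarrow> \<exists>d>0. \<forall>\<^sub>F n in sequentially. nearly_convex_on (ball xbar d) e (Fn n)"
    for \<gamma> Fn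
  proof (cases "liminf (\<lambda>n. stat_measure \<gamma> (Fn n) \<phi> (x n)) < \<infinity>")
    case True
    obtain l where l: "l \<in> regular_subdiff (\<lambda>u. ereal (f u)) xbar"
      "ereal (inverse \<gamma> * norm (xbar - prox \<gamma> \<phi> (xbar - \<gamma> *\<^sub>R l)))
        \<le> liminf (\<lambda>n. stat_measure \<gamma> (Fn n) \<phi> (x n))"
      using stat_measure_liminf_attained[OF phi \<open>\<gamma> > 0\<close> f_cont x unif Fn True] by blast
    have "l \<in> subdiff (\<lambda>u. ereal (f u)) xbar" using l(1) regular_subdiff_subset_subdiff by blast
    from stat_measure_le[OF this] l(2) show ?thesis by (rule order_trans)
  qed simp
  have a: "stat_measure \<gamma> f \<phi> xbar \<le> liminf (\<lambda>n. stat_measure \<gamma> f \<phi> (x n))" if "\<gamma> > 0" for \<gamma>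
  proof (rule lower[OF that])
    show "\<exists>d>0. \<forall>\<^sub>F n in sequentially. nearly_convex_on (ball xbar d) e f" if "e > 0" for e
      using nc[OF that] lip g_wc unfolding f eventually_const[OF sequentially_bot] by blast
  qed simp
  have b: "(\<forall>\<gamma>>0. liminf (\<lambda>n. stat_measure \<gamma> (fn n) \<phi> (x n)) \<ge> stat_measure \<gamma> f \<phi> xbar) \<and>
       ((\<exists>\<gamma>>0. liminf (\<lambda>n. stat_measure \<gamma> (fn n) \<phi> (x n)) = 0) \<longrightarrow>
          stationary_point (\<lambda>u. ereal (f u) + \<phi> u) xbar)"
    if \<mu>: "\<And>n. 0 < \<mu> n" "\<mu> \<longlonglongrightarrow> 0" and fn: "\<And>n. fn n = (\<lambda>u. h u + moreau_envelope (\<mu> n) g (S u))"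
    for \<mu> and fn :: "nat \<Rightarrow> 'a \<Rightarrow> real"
  proof -
    have unif: "\<forall>\<^sub>F n in sequentially. \<forall>u. \<bar>fn n u - f u\<bar> \<le> e" if "e > 0" for e
    proof -
      have "(\<lambda>n. K\<^sup>2 * \<mu> n / 2) \<longlonglongrightarrow> K\<^sup>2 * 0 / 2" by (intro tendsto_intros \<mu>(2)) auto
      then have "\<forall>\<^sub>F n in sequentially. K\<^sup>2 * \<mu> n / 2 < e" using that by (auto intro: order_tendstoD)
      then show ?thesis
      proof eventually_elim
        case (elim n)
        show ?case
        proof
          fix u
          show "\<bar>fn n u - f u\<bar> \<le> e"
            using moreau_envelope_approx[OF lip \<mu>(1), of n "S u"] elim unfolding fn f by simp
        qed
      qed
    qed
    have small: "\<forall>\<^sub>F n in sequentially. 2 * \<mu> n * \<eta> \<le> 1"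
    proof -
      have "(\<lambda>n. 2 * \<mu> n * \<eta>) \<longlonglongrightarrow> 2 * 0 * \<eta>" by (intro tendsto_intros \<mu>(2))
      then have "\<forall>\<^sub>F n in sequentially. 2 * \<mu> n * \<eta> < 1" by (rule order_tendstoD) simp
      then show ?thesis by eventually_elim simp
    qed
    have Fn: "\<exists>d>0. \<forall>\<^sub>F n in sequentially. nearly_convex_on (ball xbar d) e (fn n)" if "e > 0" for e
    proof -
      obtain d where d: "d > 0" "\<And>G. K-lipschitz_on UNIV G \<Longrightarrow>
         (\<And>a b t. 0 < t \<and> t < 1 \<Longrightarrow> G ((1 - t) *\<^sub>R a + t *\<^sub>R b) \<le>
            (1 - t) * G a + t * G b + \<eta> * (t * (1 - t)) * (norm (a - b))\<^sup>2) \<Longrightarrow>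
         nearly_convex_on (ball xbar d) e (\<lambda>u. h u + G (S u))"
        using nc[OF \<open>e > 0\<close>] by blast
      from small have "\<forall>\<^sub>F n in sequentially. nearly_convex_on (ball xbar d) e (fn n)"
      proof eventually_elim
        case (elim n)
        show ?case unfolding fn
          by (intro d(2) moreau_envelope_lipschitz[OF lip \<mu>(1)]
              moreau_envelope_weakly_convex[OF lip \<mu>(1) elim g_weakly_convex]) auto
      qed
      with d(1) show ?thesis by blast
    qed
    have "stationary_point (\<lambda>u. ereal (f u) + \<phi> u) xbar"
      if "\<gamma> > 0" and z: "liminf (\<lambda>n. stat_measure \<gamma> (fn n) \<phi> (x n)) = 0" for \<gamma>
    proof -
      obtain l where l: "l \<in> regular_subdiff (\<lambda>u. ereal (f u)) xbar"
        "ereal (inverse \<gamma> * norm (xbar - prox \<gamma> \<phi> (xbar - \<gamma> *\<^sub>R l)))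
          \<le> liminf (\<lambda>n. stat_measure \<gamma> (fn n) \<phi> (x n))"
        using stat_measure_liminf_attained[OF phi \<open>\<gamma> > 0\<close> f_cont x unif Fn] z by auto
      have "prox \<gamma> \<phi> (xbar - \<gamma> *\<^sub>R l) = xbar"
        using l(2) \<open>\<gamma> > 0\<close> unfolding z by (auto simp: mult_le_0_iff)
      with prox_fixed_point_stationary[OF phi \<open>\<gamma> > 0\<close> l(1)] show ?thesis .
    qed
    then show ?thesis using lower[OF _ unif Fn] by blast
  qed
  show ?thesis using a b by blast
qed

end
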